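(* Let $n\geq 16$ be an integer. Then $$ex_{ori}(n,\overrightarrow{S_{2,1}})=\left\lfloor\frac{(n+1)^2}{4}\right\rfloor.$$ Moreover, an oriented graph $D$ of order $n$ is $\overrightarrow{S_{2,1}}$-free with exactly $ex_{ori}(n,\overrightarrow{S_{2,1}})$ arcs if and only if $V(D)$ has a partition $V(D)=X\cup Y$ such that (i) $|X|\in\{\lfloor (n-1)/2\rfloor,\lceil (n-1)/2\rceil\}$; (ii) $xy\in A(D)$ for all $x\in X$, $y\in Y$; (iii) $D[X]$ has no arcs, and $D[Y]$ is an in-degree $1$-regular digraph (every vertex of $D[Y]$ has in-degree exactly $1$ in $D[Y]$).
   Context: An oriented graph is a digraph obtained from a finite simple undirected graph by choosing an orientation for each edge (so no loops, and at most one arc between any two vertices). For a digraph $F$, $D$ is $F$-free if it contains no subgraph isomorphic to $F$. The oriented Turán number $ex_{ori}(n,F)$ is the maximum number of arcs in an $F$-free oriented graph on $n$ vertices. For a positive integer $k$, $\overrightarrow{S_{k,1}}$ is the $1$-subdivision of the in-star with $k$ leaves: it has vertices $v$ (the center), $w_1,\dots,w_k$, $z_1,\dots,z_k$, and arcs $z_iw_i$ and $w_iv$ for $i=1,\dots,k$. $D[X]$ denotes the subdigraph induced by $X$. *)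

theory Defs
  imports Complex_Main "Graph_Theory.Graph_Theory"
begin

text \<open>
  The locale \<^locale>\<open>digraph\<close> already excludes infinite digraphs, loops and parallel arcs;
  an oriented graph has no pair of opposite arcs either.
\<close>

locale oriented_graph = digraph +
  assumes no_opposite_arcs: "u \<rightarrow> v \<Longrightarrow> \<not> v \<rightarrow> u"

definition digraph_free :: "('c, 'd) pre_digraph \<Rightarrow> ('a, 'b) pre_digraph \<Rightarrow> bool" where
  "digraph_free F D \<longleftrightarrow> \<not> (\<exists>H. subgraph H D \<and> digraph_iso H F)"

text \<open>
  Every oriented graph with finitely many vertices is isomorphic to one whose vertices are natural
  numbers and whose arcs are pairs of them, so fixing these types loses no values. For fixed \<open>n\<close>
  the number of arcs is at most \<open>n\<^sup>2\<close>, so the maximum is taken over a finite set.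
\<close>

definition ex_ori :: "nat \<Rightarrow> ('c, 'd) pre_digraph \<Rightarrow> nat" where
  "ex_ori n F = Max {card (arcs D) | D :: (nat, nat \<times> nat) pre_digraph.
     oriented_graph D \<and> card (verts D) = n \<and> digraph_free F D}"

datatype star_vertex = Center | Mid nat | Leaf nat

text \<open>
  The 1-subdivision of the in-star with \<open>k\<close> leaves: \<open>Center\<close> is $v$, \<open>Mid i\<close> is $w_i$ and
  \<open>Leaf i\<close> is $z_i$.
\<close>

definition subdivided_in_star :: "nat \<Rightarrow> (star_vertex, star_vertex \<times> star_vertex) pre_digraph" where
  "subdivided_in_star k = with_proj
     \<lparr> pverts = {Center} \<union> Mid ` {1..k} \<union> Leaf ` {1..k},
       parcs = {(Leaf i, Mid i) | i. i \<in> {1..k}} \<union> {(Mid i, Center) | i. i \<in> {1..k}} \<rparr>"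

end

theory Submission
  imports Defs
begin

text \<open>
  Let \<open>v\<close> be a vertex of maximum in-degree \<open>D\<close>, with in-neighbourhood \<open>I\<close>. The vertices outside \<open>I\<close>
  receive at most \<open>D (n - D)\<close> arcs. Inside \<open>I\<close>, two vertices \<open>w\<close>, \<open>w'\<close> cannot have distinct
  in-neighbours \<open>z \<noteq> w'\<close> and \<open>z' \<noteq> w\<close>, which makes almost all in-degrees in \<open>I\<close> at most 1; so \<open>I\<close> receives
  at most \<open>D\<close> arcs, up to an excess that is paid for by vertices of in-degree at most 2 outside \<open>I\<close>.
  Hence there are at most \<open>D (n + 1 - D)\<close> arcs. In the equality case all vertices outside \<open>I\<close> have
  in-degree \<open>D\<close>, and since a vertex has at most one in-neighbour of in-degree at least 3, this forces
  \<open>I\<close> to consist of \<open>D - 1\<close> sources and one further vertex.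
\<close>

section \<open>Oriented relations without a subdivided in-star\<close>

locale finite_oriented_relation =
  fixes V :: "'a set" and E :: "('a \<times> 'a) set"
  assumes finite_V: "finite V"
    and E_sub: "E \<subseteq> V \<times> V"
    and asym: "(u, v) \<in> E \<Longrightarrow> (v, u) \<notin> E"
begin

definition in_nbrs :: "'a \<Rightarrow> 'a set" where
  "in_nbrs v = {u. (u, v) \<in> E}"

lemma in_nbrs_iff [simp]: "u \<in> in_nbrs v \<longleftrightarrow> (u, v) \<in> E"
  by (simp add: in_nbrs_def)

lemma in_nbrs_subset: "in_nbrs v \<subseteq> V"
  using E_sub by auto

lemma finite_in_nbrs [simp]: "finite (in_nbrs v)"
  using in_nbrs_subset finite_V finite_subset by blast

lemma not_loop [simp]: "(v, v) \<notin> E"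
  using asym by blast

lemma card_eq_sum_card_in_nbrs: "card E = (\<Sum>v\<in>V. card (in_nbrs v))"
proof -
  have "E = (\<lambda>(v, u). (u, v)) ` (SIGMA v:V. in_nbrs v)"
    using E_sub by force
  moreover have "inj_on (\<lambda>(v, u). (u, v)) (SIGMA v:V. in_nbrs v)"
    by (auto simp: inj_on_def)
  ultimately have "card E = card (SIGMA v:V. in_nbrs v)"
    by (metis card_image)
  then show ?thesis
    by (simp add: finite_V)
qed

text \<open>Distinctness of the other pairs of vertices follows from asymmetry.\<close>

definition subdivided_star_free :: bool where
  "subdivided_star_free \<longleftrightarrow> \<not> (\<exists>v w1 w2 z1 z2.
     (z1, w1) \<in> E \<and> (w1, v) \<in> E \<and> (z2, w2) \<in> E \<and> (w2, v) \<in> E \<and>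
     w1 \<noteq> w2 \<and> z1 \<noteq> z2 \<and> z1 \<noteq> w2 \<and> z2 \<noteq> w1)"

text \<open>The size of \<open>X\<close> is left out, so that the structure can be derived for any
  maximum in-degree before the sizes are optimised.\<close>

definition extremal_partition :: "'a set \<Rightarrow> 'a set \<Rightarrow> bool" where
  "extremal_partition X Y \<longleftrightarrow> V = X \<union> Y \<and> X \<inter> Y = {} \<and> X \<times> Y \<subseteq> E \<and>
     E \<inter> X \<times> X = {} \<and> (\<forall>y\<in>Y. card (in_nbrs y \<inter> Y) = 1)"

text \<open>An arc from \<open>Y\<close> to \<open>X\<close> would oppose one from \<open>X\<close>
  to \<open>Y\<close>, so \<open>X\<close> consists of sources. Hence both middle vertices of a
  subdivided star would lie in \<open>Y\<close> and be two in-neighbours of its centre there; and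
  each vertex of \<open>Y\<close> has all of \<open>X\<close> and one vertex of \<open>Y\<close> as
  in-neighbours.\<close>

lemma extremal_partition_sound:
  assumes "extremal_partition X Y"
  shows "subdivided_star_free" and "card E = card Y * (card X + 1)"
proof -
  have V: "V = X \<union> Y" "X \<inter> Y = {}" and XY: "X \<times> Y \<subseteq> E" and XX: "E \<inter> X \<times> X = {}"
    and YY: "\<And>y. y \<in> Y \<Longrightarrow> card (in_nbrs y \<inter> Y) = 1"
    using assms by (auto simp: extremal_partition_def)
  have fin: "finite X" "finite Y"
    using finite_V V by auto
  have X_src: "in_nbrs x = {}" if x: "x \<in> X" for x
  proof -
    have "(u, x) \<notin> E" for u
    proof
      assume ux: "(u, x) \<in> E"
      then have "u \<in> X \<or> u \<in> Y"
        using E_sub V by auto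
      then show False
        using ux x XX XY asym by blast
    qed
    then show ?thesis by auto
  qed
  have in_Y: "w \<in> Y" if "(z, w) \<in> E" for z w
    using X_src[of w] that E_sub V(1) by (metis SigmaD2 UnE empty_iff in_nbrs_iff subsetD)
  show "subdivided_star_free"
    unfolding subdivided_star_free_def
  proof clarify
    fix v w1 w2 z1 z2
    assume E: "(z1, w1) \<in> E" "(w1, v) \<in> E" "(z2, w2) \<in> E" "(w2, v) \<in> E" and "w1 \<noteq> w2"
    have "card (in_nbrs v \<inter> Y) = 1" using YY in_Y E by blast
    moreover have "w1 \<in> in_nbrs v \<inter> Y" "w2 \<in> in_nbrs v \<inter> Y"
      using E in_Y by auto
    ultimately show False
      using \<open>w1 \<noteq> w2\<close> by (metis card_1_singletonE singletonD)
  qed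
  have deg: "card (in_nbrs y) = card X + 1" if y: "y \<in> Y" for y
  proof -
    have "in_nbrs y = X \<union> (in_nbrs y \<inter> Y)"
      using in_nbrs_subset[of y] V XY y by auto
    then have "card (in_nbrs y) = card (X \<union> (in_nbrs y \<inter> Y))"
      by simp
    also have "\<dots> = card X + card (in_nbrs y \<inter> Y)"
      using fin V by (intro card_Un_disjoint) auto
    finally show ?thesis
      using YY[OF y] by simp
  qed
  have "card E = (\<Sum>v\<in>X. card (in_nbrs v)) + (\<Sum>v\<in>Y. card (in_nbrs v))"
    unfolding card_eq_sum_card_in_nbrs V(1) using fin V by (intro sum.union_disjoint) auto
  then show "card E = card Y * (card X + 1)"
    using X_src deg by simp
qed

end

section \<open>In-neighbourhoods of star-free relations and the bound for a given maximum
  in-degree\<close>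

locale star_free_relation = finite_oriented_relation +
  assumes star_free: "subdivided_star_free"
begin

lemma no_star:
  assumes "(z1, w1) \<in> E" "(w1, v) \<in> E" "(z2, w2) \<in> E" "(w2, v) \<in> E"
    and "w1 \<noteq> w2" "z1 \<noteq> z2" "z1 \<noteq> w2" "z2 \<noteq> w1"
  shows False
  using star_free assms unfolding subdivided_star_free_def by blast

text \<open>An in-neighbour of \<open>c\<close> outside \<open>{u, w}\<close> would complete a
  subdivided in-star centred at \<open>v\<close> with middle vertices \<open>c\<close> and
  \<open>w\<close>.\<close>

lemma in_nbrs_subset_pair:
  assumes "(c, v) \<in> E" "(w, v) \<in> E" "c \<noteq> w" "(u, w) \<in> E" "u \<noteq> c"
  shows "in_nbrs c \<subseteq> {u, w}"
proof
  fix x assume "x \<in> in_nbrs c"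
  then show "x \<in> {u, w}" using no_star[of x c v u w] assms by fastforce
qed

text \<open>Three in-neighbours of \<open>c\<close> do not fit into the pair given by
  \<open>in_nbrs_subset_pair\<close>, so \<open>w\<close> has no in-neighbour other than
  \<open>c\<close>.\<close>

lemma in_nbrs_of_sibling:
  assumes "(c, v) \<in> E" "3 \<le> card (in_nbrs c)" "(w, v) \<in> E" "w \<noteq> c"
  shows "in_nbrs w \<subseteq> {c}"
proof (rule ccontr)
  assume "\<not> in_nbrs w \<subseteq> {c}"
  then obtain u where "(u, w) \<in> E" "u \<noteq> c" by fastforce
  then have "in_nbrs c \<subseteq> {u, w}"
    using in_nbrs_subset_pair assms by metis
  then have "card (in_nbrs c) \<le> card {u, w}"
    by (intro card_mono) auto
  also have "\<dots> \<le> 2"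
    by (simp add: card_insert_if)
  finally show False using assms by simp
qed

text \<open>Siblings of \<open>c\<close> have in-degree at most 1. This limits every vertex to one
  in-neighbour of in-degree at least 3, which drives the equality case.\<close>

lemma high_in_nbr_unique:
  assumes "(c, v) \<in> E" "3 \<le> card (in_nbrs c)" "(w, v) \<in> E" "2 \<le> card (in_nbrs w)"
  shows "w = c"
proof (rule ccontr)
  assume "w \<noteq> c"
  then have "card (in_nbrs w) \<le> card {c}"
    using in_nbrs_of_sibling assms by (intro card_mono) auto
  then show False using assms by simp
qed

text \<open>If \<open>c\<close> has in-degree at least 2 but is no \<open>centre\<close>, a sibling
  \<open>w\<close> has an in-neighbour \<open>u\<close> other than \<open>c\<close>. This determines
  everything: \<open>in_nbrs c\<close> is \<open>{u, w}\<close>, \<open>in_nbrs w\<close> is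
  \<open>{u}\<close>, all other siblings are sources, and the sum is 3.\<close>

lemma in_neighbourhood_cases:
  assumes "4 \<le> card (in_nbrs v)"
  obtains (sparse) "(\<Sum>w\<in>in_nbrs v. card (in_nbrs w)) < card (in_nbrs v)"
    | (low) "\<forall>w\<in>in_nbrs v. card (in_nbrs w) \<le> 1"
    | (centre) c where "(c, v) \<in> E" "2 \<le> card (in_nbrs c)"
        "\<forall>w\<in>in_nbrs v - {c}. in_nbrs w \<subseteq> {c}"
proof (cases "\<forall>w\<in>in_nbrs v. card (in_nbrs w) \<le> 1")
  case True
  then show ?thesis by (rule low)
next
  case False
  then obtain c where c: "(c, v) \<in> E" "2 \<le> card (in_nbrs c)"
    by (auto simp: not_le)
  show ?thesis
  proof (cases "\<forall>w\<in>in_nbrs v - {c}. in_nbrs w \<subseteq> {c}")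
    case True
    then show ?thesis using c centre by blast
  next
    case False
    then obtain w u where w: "(w, v) \<in> E" "w \<noteq> c" and u: "(u, w) \<in> E" "u \<noteq> c"
      by fastforce
    have sub: "in_nbrs c \<subseteq> {t, w}" if "(t, w) \<in> E" "t \<noteq> c" for t
      using in_nbrs_subset_pair that c w by metis
    have "u \<noteq> w" using u by auto
    have eq: "in_nbrs c = {u, w}"
      using sub[OF u] c(2) \<open>u \<noteq> w\<close> by (intro card_seteq) auto
    then have uc: "(u, c) \<in> E" and wc: "(w, c) \<in> E"
      by (auto simp flip: in_nbrs_iff)
    have w_in: "in_nbrs w = {u}"
    proof -
      have "t = u" if "(t, w) \<in> E" for t
      proof -
        have "t \<noteq> c" using that wc asym by blast
        then have "in_nbrs c \<subseteq> {t, w}" using sub that by blast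
        then show ?thesis using eq \<open>u \<noteq> w\<close> by blast
      qed
      then show ?thesis using u unfolding in_nbrs_def by blast
    qed
    \<comment> \<open>A tail \<open>t\<close> other than \<open>c\<close> would make
      \<open>{t, r}\<close> equal to \<open>{u, w}\<close> and reverse the arc from \<open>u\<close>
      to \<open>w\<close>; \<open>t = c\<close> gives a star with middle vertices \<open>w\<close>
      and \<open>r\<close>.\<close>
    have rest: "in_nbrs r = {}" if r: "(r, v) \<in> E" "r \<noteq> c" "r \<noteq> w" for r
    proof -
      have "(t, r) \<notin> E" for t
      proof
        assume tr: "(t, r) \<in> E"
        have "t = c"
        proof (rule ccontr)
          assume "t \<noteq> c"
          then have "in_nbrs c \<subseteq> {t, r}"
            using in_nbrs_subset_pair tr r c by metis
          then have "t = w" "r = u" using eq r \<open>u \<noteq> w\<close> by auto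
          then show False using tr u asym by blast
        qed
        moreover have "u \<noteq> r" using tr \<open>t = c\<close> uc asym by blast
        ultimately show False
          using no_star[of u w v c r] u w r tr by auto
      qed
      then show ?thesis by auto
    qed
    have "(\<Sum>x\<in>in_nbrs v. card (in_nbrs x)) = (\<Sum>x\<in>{c, w}. card (in_nbrs x))"
      using c w rest by (intro sum.mono_neutral_right) auto
    also have "\<dots> = 3"
      using w w_in eq \<open>u \<noteq> w\<close> by simp
    finally show ?thesis using assms by (intro sparse) simp
  qed
qed

text \<open>The target amounts to \<open>D\<close> arcs into \<open>I\<close> plus \<open>D\<close>
  for each vertex of \<open>H\<close>. The three cases of \<open>in_neighbourhood_cases\<close>
  control the arcs into \<open>I\<close>; only \<open>centre\<close> survives the equality
  analysis.\<close>

lemma card_E_le_max_in_degree: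
  assumes v: "v \<in> V" and D: "card (in_nbrs v) = D" "4 \<le> D"
    and max: "\<And>u. u \<in> V \<Longrightarrow> card (in_nbrs u) \<le> D"
  shows "card E \<le> D * (card V + 1 - D)"
    and "card E = D * (card V + 1 - D) \<Longrightarrow>
      \<exists>X Y. extremal_partition X Y \<and> card X = D - 1"
proof -
  define I where "I = in_nbrs v"
  define H where "H = V - I"
  define SI where "SI = (\<Sum>w\<in>I. card (in_nbrs w))"
  define SH where "SH = (\<Sum>w\<in>H. card (in_nbrs w))"
  have I_sub: "I \<subseteq> V" using in_nbrs_subset by (simp add: I_def)
  have fin: "finite I" "finite H" using finite_V by (auto simp: I_def H_def)
  have card_I: "card I = D" using D by (simp add: I_def)
  have "card V = card I + card H"
    using I_sub finite_V unfolding H_def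
    by (metis card_Diff_subset card_mono fin(1) le_add_diff_inverse)
  then have card_V: "card V + 1 - D = card H + 1" using card_I by simp
  have E: "card E = SI + SH"
    unfolding SI_def SH_def card_eq_sum_card_in_nbrs H_def
    using sum.subset_diff[OF I_sub finite_V] by (metis add.commute)
  have SH: "SH \<le> D * card H"
    using sum_bounded_above[of H "\<lambda>w. card (in_nbrs w)" D] max
    by (auto simp: SH_def H_def mult.commute)
  have H_full: "card (in_nbrs u) = D" if "SH = D * card H" "u \<in> H" for u
  proof (rule ccontr)
    assume "card (in_nbrs u) \<noteq> D"
    then have "card (in_nbrs u) < D" using max that by (simp add: H_def le_neq_implies_less)
    then have "SH < (\<Sum>w\<in>H. D)"
      unfolding SH_def using fin that max by (intro sum_strict_mono_ex1) (auto simp: H_def)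
    then show False using that by simp
  qed
  have H_full_unique: "u = u'" if "SH = D * card H" "u \<in> H" "u' \<in> H" "(u, y) \<in> E" "(u', y) \<in> E"
    for u u' y
    using high_in_nbr_unique[of u' y u] H_full that D by simp
  \<comment> \<open>As \<open>c\<close> is in \<open>I\<close> but is no in-neighbour of
    \<open>z\<close>, the \<open>D\<close> in-neighbours of \<open>z\<close> cannot all lie in
    \<open>I\<close>. One of them, \<open>h\<close>, is in \<open>H\<close>, and its in-degree
    \<open>D\<close> constrains its siblings.\<close>
  have full_in_nbrs: "\<exists>h\<in>H. (h, z) \<in> E \<and> (\<forall>w\<in>in_nbrs z - {h}. w \<in> I - {c} \<and> in_nbrs w \<subseteq> {h})"
    if SHD: "SH = D * card H" and z: "z \<in> H" "(z, c) \<in> E" and c: "c \<in> I" for z c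
  proof -
    have "c \<notin> in_nbrs z" using z asym by auto
    have "\<not> in_nbrs z \<subseteq> I"
    proof
      assume "in_nbrs z \<subseteq> I"
      then have "in_nbrs z \<subset> I" using \<open>c \<notin> in_nbrs z\<close> c by auto
      then have "card (in_nbrs z) < D" using psubset_card_mono fin card_I by metis
      then show False using H_full SHD z by simp
    qed
    then obtain h where h: "h \<in> H" "(h, z) \<in> E"
      using in_nbrs_subset[of z] by (fastforce simp: H_def)
    have "w \<in> I - {c} \<and> in_nbrs w \<subseteq> {h}" if w: "w \<in> in_nbrs z - {h}" for w
    proof
      have "w \<notin> H" using H_full_unique[OF SHD, of w h z] h w by auto
      then show "w \<in> I - {c}" using w \<open>c \<notin> in_nbrs z\<close> in_nbrs_subset[of z] by (auto simp: H_def)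
      show "in_nbrs w \<subseteq> {h}"
        using in_nbrs_of_sibling[of h z w] h w H_full[OF SHD] D by auto
    qed
    then show ?thesis using h by blast
  qed
  have goal: "card E \<le> D * (card V + 1 - D) \<and> (card E = D * (card V + 1 - D) \<longrightarrow>
      (\<exists>X Y. extremal_partition X Y \<and> card X = D - 1))"
    if "SI + SH \<le> D + D * card H"
      "SI + SH = D + D * card H \<Longrightarrow> \<exists>X Y. extremal_partition X Y \<and> card X = D - 1"
    using that unfolding card_V E by (simp add: algebra_simps)
  have "4 \<le> card (in_nbrs v)" using D by simp
  then have "card E \<le> D * (card V + 1 - D) \<and> (card E = D * (card V + 1 - D) \<longrightarrow>
      (\<exists>X Y. extremal_partition X Y \<and> card X = D - 1))"
  proof (cases rule: in_neighbourhood_cases)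
    case sparse
    then have "SI < D" using card_I by (simp add: SI_def I_def)
    then show ?thesis using SH by (intro goal) auto
  next
    case low
    then have SI: "SI \<le> D"
      using sum_bounded_above[of I "\<lambda>w. card (in_nbrs w)" 1] card_I by (simp add: SI_def I_def)
    show ?thesis
    proof (intro goal)
      show "SI + SH \<le> D + D * card H" using SI SH by simp
      assume eq: "SI + SH = D + D * card H"
      then have SHD: "SH = D * card H" and SID: "SI = D" using SI SH by auto
      have one: "card (in_nbrs w) = 1" if w: "w \<in> I" for w
      proof (rule ccontr)
        assume "card (in_nbrs w) \<noteq> 1"
        then have "card (in_nbrs w) < 1" using low w unfolding I_def by (metis le_neq_implies_less)
        then have "SI < (\<Sum>w\<in>I. 1)"
          unfolding SI_def using fin w low by (intro sum_strict_mono_ex1) (auto simp: I_def)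
        then show False using SID card_I by simp
      qed
      then have "\<forall>w\<in>I. \<exists>u. in_nbrs w = {u}" by (meson card_1_singletonE)
      then obtain f where f: "\<And>w. w \<in> I \<Longrightarrow> in_nbrs w = {f w}" by metis
      have f_E: "(u, w) \<in> E \<longleftrightarrow> u = f w" if "w \<in> I" for u w
        using f[OF that] by (auto simp flip: in_nbrs_iff)
      have pair: "f w = w' \<or> f w' = w \<or> f w = f w'" if "w \<in> I" "w' \<in> I" "w \<noteq> w'" for w w'
        using no_star[of "f w" w v "f w'" w'] that f_E by (auto simp: I_def)
      \<comment> \<open>Four vertices of in-degree 1 receive at most four arcs but form six pairs,
        so some pair is not joined by an arc and shares its in-neighbour by
        \<open>pair\<close>.\<close>
      obtain a b where ab: "a \<in> I" "b \<in> I" "a \<noteq> b" "f a = f b"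
      proof -
        obtain T where T: "T \<subseteq> I" "card T = 4"
          using D card_I obtain_subset_with_card_n by metis
        then obtain p q r s where "T = {p, q, r, s}" "distinct [p, q, r, s]"
          by (auto simp: card_Suc_eq numeral_eq_Suc)
        then have *: "p \<in> I" "q \<in> I" "r \<in> I" "s \<in> I" "distinct [p, q, r, s]"
          using T by auto
        show ?thesis
          using pair[of p q] pair[of p r] pair[of p s] pair[of q r] pair[of q s] pair[of r s]
            * that[of p q] that[of p r] that[of p s] that[of q r] that[of q s] that[of r s]
          by auto
      qed
      define c where "c = f a"
      \<comment> \<open>Otherwise \<open>f w\<close> would have to be both \<open>a\<close> and
        \<open>b\<close>.\<close>
      have c: "f w = c" if w: "w \<in> I" "w \<noteq> c" for w
        using pair[OF w(1) ab(1)] pair[OF w(1) ab(2)] w ab by (metis c_def)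
      \<comment> \<open>There is no place for \<open>c\<close>. If it is in \<open>I\<close>, then
        \<open>f c\<close> is in \<open>H\<close> and has an in-neighbour in \<open>I\<close> whose
        only in-neighbour is \<open>c\<close> but should be \<open>h\<close>. If it is in
        \<open>H\<close>, its \<open>D\<close> in-neighbours all lie in \<open>H\<close>, where only
        one is possible.\<close>
      have False
      proof (cases "c \<in> I")
        case True
        have "f c \<notin> I"
        proof
          assume "f c \<in> I"
          moreover have "f c \<noteq> c" using f_E True not_loop by metis
          ultimately show False using c f_E True asym by metis
        qed
        moreover have "(f c, c) \<in> E" using f_E True by blast
        ultimately obtain h where h: "h \<in> H"
            "\<forall>w\<in>in_nbrs (f c) - {h}. w \<in> I - {c} \<and> in_nbrs w \<subseteq> {h}" "(h, f c) \<in> E"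
          using full_in_nbrs[OF SHD, of "f c" c] True E_sub by (auto simp: H_def)
        have "f c \<in> H" using \<open>f c \<notin> I\<close> \<open>(f c, c) \<in> E\<close> E_sub by (auto simp: H_def)
        then have "card (in_nbrs (f c) - {h}) = D - 1"
          using H_full[OF SHD] h by simp
        then have "in_nbrs (f c) - {h} \<noteq> {}" using D by force
        then obtain w where "w \<in> in_nbrs (f c) - {h}" by blast
        then have "w \<in> I" "w \<noteq> c" "in_nbrs w \<subseteq> {h}" using h by auto
        then have "c = h" using c f by auto
        then show False using True h by (auto simp: H_def)
      next
        case False
        have "c \<in> H" using False ab f_E[of a] E_sub by (auto simp: H_def c_def)
        have "in_nbrs c \<subseteq> H"
        proof
          fix x assume x: "x \<in> in_nbrs c"
          have "x \<notin> I"
          proof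
            assume "x \<in> I"
            then have "(c, x) \<in> E" using c f_E False by metis
            then show False using x asym by auto
          qed
          then show "x \<in> H" using x E_sub by (auto simp: H_def)
        qed
        then have "card (in_nbrs c) \<le> 1"
          using H_full_unique[OF SHD] by (auto simp: card_le_Suc0_iff_eq subset_iff)
        then show False using H_full[OF SHD \<open>c \<in> H\<close>] D by simp
      qed
      then show "\<exists>X Y. extremal_partition X Y \<and> card X = D - 1" ..
    qed
  next
    case (centre c)
    txt \<open>
      Every arc between \<open>c\<close> and \<open>I\<close> uses up its own vertex of \<open>I - {c}\<close>, so \<open>I\<close> receives at most
      \<open>D - 1 + card K\<close> arcs. All but one vertex of \<open>K\<close> lie in \<open>K'\<close>, and each of these falls short
      of in-degree \<open>D\<close> by at least 2.
    \<close>
    define S where "S = {w \<in> I. (c, w) \<in> E}"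
    define K where "K = in_nbrs c - I"
    define K' where "K' = {z \<in> K. card (in_nbrs z) \<le> 2}"
    have c: "c \<in> I" using centre by (simp add: I_def)
    have others: "in_nbrs w \<subseteq> {c}" if "w \<in> I" "w \<noteq> c" for w
      using centre that by (auto simp: I_def)
    have finS: "finite S" "finite K" using fin by (auto simp: S_def K_def)
    have "K' \<subseteq> K" by (auto simp: K'_def)
    then have finK': "finite K'" using finS finite_subset by blast
    have "(\<Sum>w\<in>I - {c}. card (in_nbrs w)) = (\<Sum>w\<in>S. card (in_nbrs w))"
    proof (rule sum.mono_neutral_right)
      show "\<forall>i\<in>I - {c} - S. card (in_nbrs i) = 0"
      proof
        fix i assume "i \<in> I - {c} - S"
        then have "in_nbrs i \<subseteq> {c}" "c \<notin> in_nbrs i" using others by (auto simp: S_def)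
        then have "in_nbrs i = {}" by blast
        then show "card (in_nbrs i) = 0" by simp
      qed
    qed (use fin in \<open>auto simp: S_def\<close>)
    also have "\<dots> = (\<Sum>w\<in>S. 1)"
    proof (rule sum.cong)
      fix w assume "w \<in> S"
      then have "w \<in> I" "w \<noteq> c" "c \<in> in_nbrs w" by (auto simp: S_def)
      then have "in_nbrs w = {c}" using others[of w] by blast
      then show "card (in_nbrs w) = 1" by simp
    qed simp
    finally have SI: "SI = card (in_nbrs c) + card S"
      unfolding SI_def using sum.remove[OF fin(1) c, of "\<lambda>w. card (in_nbrs w)"] by simp
    have in_c: "card (in_nbrs c) = card (in_nbrs c \<inter> I) + card K"
      unfolding K_def by (metis Int_Diff_Un Int_Diff_disjoint card_Un_disjoint
        finite_Diff finite_Int finite_in_nbrs)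
    have disj: "in_nbrs c \<inter> I \<union> S \<subseteq> I - {c}" "(in_nbrs c \<inter> I) \<inter> S = {}"
      using asym by (auto simp: S_def)
    have card_IS: "card (in_nbrs c \<inter> I \<union> S) = card (in_nbrs c \<inter> I) + card S"
      using disj finS by (intro card_Un_disjoint) auto
    have card_Ic: "card (I - {c}) = D - 1" using c card_I by simp
    have le: "card (in_nbrs c \<inter> I) + card S \<le> D - 1"
      using card_mono[OF _ disj(1)] fin card_IS card_Ic by simp
    \<comment> \<open>Both are in-neighbours of \<open>c\<close> with in-degree at least 3.\<close>
    have "x = y" if "x \<in> K - K'" "y \<in> K - K'" for x y
      using high_in_nbr_unique[of y c x] that by (fastforce simp: K_def K'_def)
    then have "card (K - K') \<le> 1"
      using finS by (simp add: card_le_Suc0_iff_eq del: Diff_iff)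
    moreover have "card K = card K' + card (K - K')"
      using finS finK' \<open>K' \<subseteq> K\<close> by (simp add: card_Diff_subset card_mono)
    ultimately have K: "card K \<le> card K' + 1" by simp
    have "K' \<subseteq> H" using E_sub by (auto simp: K'_def K_def H_def)
    then have K'H: "card K' \<le> card H" using fin card_mono by blast
    have "SH = (\<Sum>w\<in>H - K'. card (in_nbrs w)) + (\<Sum>w\<in>K'. card (in_nbrs w))"
      unfolding SH_def using sum.subset_diff[OF \<open>K' \<subseteq> H\<close> fin(2)] by blast
    also have "\<dots> \<le> card (H - K') * D + card K' * 2"
      using sum_bounded_above[of "H - K'" "\<lambda>w. card (in_nbrs w)" D]
        sum_bounded_above[of K' "\<lambda>w. card (in_nbrs w)" 2] max
      by (intro add_mono) (auto simp: H_def K'_def)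
    finally have SH_le: "SH \<le> card (H - K') * D + card K' * 2" .
    have "card H = card (H - K') + card K'"
      using \<open>K' \<subseteq> H\<close> K'H finK' by (simp add: card_Diff_subset)
    then have "D * card H = card (H - K') * D + card K' * D" by (simp add: algebra_simps)
    moreover have "card K' * 4 \<le> card K' * D" using D by simp
    ultimately have SH2: "SH + card K' * 2 \<le> D * card H" using SH_le by linarith
    show ?thesis
    proof (intro goal)
      show "SI + SH \<le> D + D * card H" using SI in_c le K SH2 D by simp
      assume eq: "SI + SH = D + D * card H"
      \<comment> \<open>The combined estimates leave a slack of at least \<open>card K'\<close>, so
        equality empties \<open>K'\<close> and makes each estimate tight.\<close>
      then have SHD: "SH = D * card H" and K1: "card K = 1"
        and tight: "card (in_nbrs c \<inter> I) + card S = D - 1"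
        using SI in_c le K SH2 D by linarith+
      from K1 obtain z where "K = {z}" by (rule card_1_singletonE)
      then have "z \<in> in_nbrs c - I" by (simp add: K_def)
      then have z: "(z, c) \<in> E" "z \<in> H" using E_sub by (auto simp: H_def)
      obtain h where h: "h \<in> H" "(h, z) \<in> E"
          "\<forall>w\<in>in_nbrs z - {h}. w \<in> I - {c} \<and> in_nbrs w \<subseteq> {h}"
        using full_in_nbrs[OF SHD z(2) z(1) c] by blast
      \<comment> \<open>A member of \<open>S\<close> has \<open>c\<close> as in-neighbour, which
        would give \<open>c = h\<close>. The \<open>D - 1\<close> vertices on the left then leave no
        room for \<open>S\<close>.\<close>
      have "in_nbrs z - {h} \<subseteq> I - {c} - S"
      proof
        fix w assume "w \<in> in_nbrs z - {h}"
        then have w: "w \<in> I - {c}" "in_nbrs w \<subseteq> {h}" using h by auto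
        moreover have "c \<noteq> h" using c h by (auto simp: H_def)
        ultimately show "w \<in> I - {c} - S" by (fastforce simp: S_def)
      qed
      then have "card (in_nbrs z - {h}) \<le> card (I - {c} - S)"
        using fin by (intro card_mono) auto
      also have "\<dots> = D - 1 - card S"
        using disj(1) finS card_Ic by (subst card_Diff_subset) auto
      finally have "D - 1 \<le> D - 1 - card S"
        using H_full[OF SHD z(2)] h by simp
      then have "card S = 0" using D by arith
      then have "S = {}" using finS by simp
      have "in_nbrs c \<inter> I = I - {c}"
        using disj(1) tight card_Ic fin \<open>S = {}\<close> by (intro card_subset_eq) auto
      \<comment> \<open>Thus \<open>Y\<close> is \<open>H\<close> together with \<open>c\<close>,
        which also has in-degree \<open>D\<close>.\<close>
      define X where "X = I - {c}"
      define Y where "Y = V - X"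
      have X_in_c: "X \<subseteq> in_nbrs c" using \<open>in_nbrs c \<inter> I = I - {c}\<close> by (auto simp: X_def)
      have X_src: "in_nbrs x = {}" if "x \<in> X" for x
      proof -
        have "x \<in> I" "x \<noteq> c" "c \<notin> in_nbrs x" using that X_in_c asym by (auto simp: X_def)
        then show ?thesis using others[of x] by blast
      qed
      have c_full: "card (in_nbrs c) = D" using in_c tight K1 \<open>S = {}\<close> D by simp
      have Y_full: "card (in_nbrs y) = D" if "y \<in> Y" for y
        using that c_full H_full[OF SHD] by (auto simp: Y_def X_def H_def)
      \<comment> \<open>The \<open>D\<close> in-neighbours of \<open>y\<close> split into at most
        \<open>D - 1\<close> in \<open>X\<close> and at most one in \<open>Y\<close>, so both bounds
        are attained.\<close>
      have Y: "X \<subseteq> in_nbrs y \<and> card (in_nbrs y \<inter> Y) = 1" if y: "y \<in> Y" for y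
      proof -
        have "in_nbrs y = (in_nbrs y \<inter> X) \<union> (in_nbrs y \<inter> Y)"
          using in_nbrs_subset by (auto simp: Y_def)
        then have "D = card ((in_nbrs y \<inter> X) \<union> (in_nbrs y \<inter> Y))"
          using Y_full y by metis
        also have "\<dots> = card (in_nbrs y \<inter> X) + card (in_nbrs y \<inter> Y)"
          by (intro card_Un_disjoint) (auto simp: Y_def)
        finally have sum: "D = card (in_nbrs y \<inter> X) + card (in_nbrs y \<inter> Y)" .
        have "u = u'" if "u \<in> in_nbrs y \<inter> Y" "u' \<in> in_nbrs y \<inter> Y" for u u'
          using high_in_nbr_unique[of u' y u] that Y_full D by simp
        then have "card (in_nbrs y \<inter> Y) \<le> 1"
          by (simp add: card_le_Suc0_iff_eq del: Int_iff)
        moreover have "card (in_nbrs y \<inter> X) \<le> card X"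
          using fin by (intro card_mono) (auto simp: X_def)
        ultimately have "card (in_nbrs y \<inter> X) = card X" "card (in_nbrs y \<inter> Y) = 1"
          using sum card_Ic D unfolding X_def by linarith+
        moreover from this have "in_nbrs y \<inter> X = X"
          using fin by (intro card_subset_eq) (auto simp: X_def)
        ultimately show ?thesis by auto
      qed
      have "extremal_partition X Y"
        unfolding extremal_partition_def
      proof (intro conjI)
        show "V = X \<union> Y" using I_sub by (auto simp: X_def Y_def)
        show "X \<times> Y \<subseteq> E" using Y in_nbrs_iff by blast
        show "E \<inter> X \<times> X = {}" using X_src in_nbrs_iff by blast
      qed (use Y in \<open>auto simp: Y_def\<close>)
      then show "\<exists>X Y. extremal_partition X Y \<and> card X = D - 1"
        using card_Ic by (auto simp: X_def)
    qed
  qed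
  then show "card E \<le> D * (card V + 1 - D)"
    and "card E = D * (card V + 1 - D) \<Longrightarrow>
      \<exists>X Y. extremal_partition X Y \<and> card X = D - 1"
    by auto
qed

end

section \<open>Products and quarter squares\<close>

lemma quarter_square_add: "(a + (a + k))\<^sup>2 div 4 = a * (a + k) + k\<^sup>2 div 4" for a k :: nat
proof -
  have "(a + (a + k))\<^sup>2 = k\<^sup>2 + a * (a + k) * 4"
    by (simp add: power2_eq_square algebra_simps)
  then show ?thesis by simp
qed

lemma square_div_4_eq_0_iff: "k\<^sup>2 div 4 = 0 \<longleftrightarrow> k \<le> 1" for k :: nat
proof -
  have "k\<^sup>2 < 2\<^sup>2 \<longleftrightarrow> k < 2"
    by (simp only: power_mono_iff power2_less_imp_less linorder_not_le[symmetric] zero_le pos2)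
  then show ?thesis by (auto simp: div_eq_0_iff)
qed

text \<open>The square of a sum is four times the product plus the squared difference, and a quarter
  of the latter rounds down to 0 exactly when the difference is at most 1.\<close>

lemma mult_le_quarter_square: "a * b \<le> (a + b)\<^sup>2 div 4"
  and mult_eq_quarter_square_iff: "a * b = (a + b)\<^sup>2 div 4 \<longleftrightarrow> a \<le> b + 1 \<and> b \<le> a + 1"
  for a b :: nat
proof -
  have *: "a * b \<le> (a + b)\<^sup>2 div 4 \<and> (a * b = (a + b)\<^sup>2 div 4 \<longleftrightarrow> b \<le> a + 1)"
    if ab: "a \<le> b" for a b :: nat
  proof -
    obtain k where k: "b = a + k" using ab le_Suc_ex by blast
    show ?thesis unfolding k quarter_square_add using square_div_4_eq_0_iff[of k] by auto
  qed
  show "a * b \<le> (a + b)\<^sup>2 div 4"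
    using *[of a b] *[of b a] by (cases "a \<le> b") (simp_all add: ac_simps)
  show "a * b = (a + b)\<^sup>2 div 4 \<longleftrightarrow> a \<le> b + 1 \<and> b \<le> a + 1"
    using *[of a b] *[of b a] by (cases "a \<le> b") (auto simp: ac_simps)
qed

section \<open>Optimising over the maximum in-degree\<close>

context star_free_relation
begin

text \<open>For \<open>D\<close> at least 4 the bound is a product of two factors with sum
  \<open>card V + 1\<close>. For smaller \<open>D\<close> the crude bound \<open>3 * card V\<close>
  already lies below the target.\<close>

theorem card_E_le_quarter_square:
  assumes n: "16 \<le> card V"
  shows "card E \<le> (card V + 1)\<^sup>2 div 4"
    and "card E = (card V + 1)\<^sup>2 div 4 \<Longrightarrow>
      \<exists>X Y. extremal_partition X Y \<and> card X \<in> {(card V - 1) div 2, card V div 2}"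
proof -
  define D where "D = Max ((\<lambda>v. card (in_nbrs v)) ` V)"
  have V: "V \<noteq> {}" using n by auto
  have "D \<in> (\<lambda>v. card (in_nbrs v)) ` V"
    unfolding D_def using V finite_V by (intro Max_in) auto
  then obtain v where v: "v \<in> V" "card (in_nbrs v) = D" by auto
  have max: "card (in_nbrs u) \<le> D" if "u \<in> V" for u
    unfolding D_def using finite_V that by (intro Max_ge) auto
  have "card E \<le> (card V + 1)\<^sup>2 div 4 \<and> (card E = (card V + 1)\<^sup>2 div 4 \<longrightarrow>
      (\<exists>X Y. extremal_partition X Y \<and> card X \<in> {(card V - 1) div 2, card V div 2}))"
  proof (cases "4 \<le> D")
    case False
    have "card E \<le> card V * D"
      unfolding card_eq_sum_card_in_nbrs using sum_bounded_above[of V _ D] max by simp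
    also have "\<dots> \<le> card V * 3" using False by simp
    also have "\<dots> < (card V + 1)\<^sup>2 div 4"
    proof -
      have "16 * card V \<le> card V * card V" using n by simp
      then have "10 * card V + 3 \<le> card V * card V" using n by linarith
      then have "(card V * 3 + 1) * 4 \<le> (card V + 1)\<^sup>2"
        by (simp add: power2_eq_square)
      then show ?thesis by (simp add: less_eq_div_iff_mult_less_eq flip: Suc_le_eq)
    qed
    finally show ?thesis by simp
  next
    case True
    define M where "M = card V + 1 - D"
    have "D \<le> card V" using v in_nbrs_subset finite_V card_mono by blast
    then have DM: "D + M = card V + 1" by (simp add: M_def)
    note bound = card_E_le_max_in_degree[OF v True max, folded M_def]
    note quarter = mult_le_quarter_square[of D M, unfolded DM]
    show ?thesis
    proof (intro conjI impI)
      show "card E \<le> (card V + 1)\<^sup>2 div 4" using bound(1) quarter by simp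
      assume "card E = (card V + 1)\<^sup>2 div 4"
      then have "card E = D * M" and DM_eq: "D * M = (D + M)\<^sup>2 div 4"
        using bound(1) quarter DM by simp_all
      then obtain X Y where XY: "extremal_partition X Y" "card X = D - 1"
        using bound(2) by blast
      \<comment> \<open>So \<open>D\<close> is half of \<open>card V + 1\<close>, rounded down or
        up; \<open>card X\<close> is one less.\<close>
      have "D \<le> M + 1 \<and> M \<le> D + 1" using DM_eq mult_eq_quarter_square_iff by blast
      then have "D - 1 \<in> {(card V - 1) div 2, card V div 2}"
        using DM True by auto
      then show "\<exists>X Y. extremal_partition X Y \<and> card X \<in> {(card V - 1) div 2, card V div 2}"
        using XY by auto
    qed
  qed
  then show "card E \<le> (card V + 1)\<^sup>2 div 4"
    and "card E = (card V + 1)\<^sup>2 div 4 \<Longrightarrow>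
      \<exists>X Y. extremal_partition X Y \<and> card X \<in> {(card V - 1) div 2, card V div 2}"
    by auto
qed

end

section \<open>Transfer to oriented graphs\<close>

sublocale oriented_graph \<subseteq> rel: finite_oriented_relation "verts G" "arcs_ends G"
proof
  show "arcs_ends G \<subseteq> verts G \<times> verts G" using adj_in_verts by auto
qed (use no_opposite_arcs in auto)

lemma subdivided_in_star_2:
  "subdivided_in_star 2 = \<lparr> verts = {Center, Mid 1, Mid 2, Leaf 1, Leaf 2},
     arcs = {(Leaf 1, Mid 1), (Leaf 2, Mid 2), (Mid 1, Center), (Mid 2, Center)},
     tail = fst, head = snd \<rparr>"
proof -
  have "{1..2} = {1, 2::nat}" by auto
  then show ?thesis
    unfolding subdivided_in_star_def with_proj_def by auto
qed

context oriented_graph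
begin

lemma card_arcs_ends: "card (arcs_ends G) = card (arcs G)"
  unfolding arcs_ends_def by (rule card_image) (rule inj_on_arc_to_ends)

lemma subdivided_star_freeI:
  assumes "digraph_free (subdivided_in_star 2) G"
  shows "rel.subdivided_star_free"
  unfolding rel.subdivided_star_free_def
proof clarify
  fix v w1 w2 z1 z2
  assume E: "z1 \<rightarrow> w1" "w1 \<rightarrow> v" "z2 \<rightarrow> w2" "w2 \<rightarrow> v"
    and ne: "w1 \<noteq> w2" "z1 \<noteq> z2" "z1 \<noteq> w2" "z2 \<noteq> w1"
  \<comment> \<open>Any of these coincidences would create a loop or a pair of opposite
    arcs.\<close>
  have ne': "z1 \<noteq> w1" "w1 \<noteq> v" "z2 \<noteq> w2" "w2 \<noteq> v" "z1 \<noteq> v" "z2 \<noteq> v"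
    using E no_opposite_arcs by blast+
  obtain e1 e2 e3 e4 where
      e1: "e1 \<in> arcs G" "tail G e1 = z1" "head G e1 = w1" and
      e2: "e2 \<in> arcs G" "tail G e2 = w1" "head G e2 = v" and
      e3: "e3 \<in> arcs G" "tail G e3 = z2" "head G e3 = w2" and
      e4: "e4 \<in> arcs G" "tail G e4 = w2" "head G e4 = v"
    using E by (meson reachableE)
  define H where "H = \<lparr> verts = {v, w1, w2, z1, z2}, arcs = {e1, e2, e3, e4},
    tail = tail G, head = head G \<rparr>"
  \<comment> \<open>The last \<open>else\<close> serves \<open>z2\<close>; \<open>g\<close> need
    only be right on the five vertices of \<open>H\<close>.\<close>
  define g where "g x = (if x = v then Center else if x = w1 then Mid 1 else if x = w2 then Mid 2
    else if x = z1 then Leaf 1 else Leaf 2)" for x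
  define f where "f = \<lparr> iso_verts = g, iso_arcs = (\<lambda>e. (g (tail G e), g (head G e))),
    iso_head = snd, iso_tail = fst \<rparr>"
  have wf: "wf_digraph H"
    by unfold_locales (use e1 e2 e3 e4 in \<open>auto simp: H_def\<close>)
  have g: "g v = Center" "g w1 = Mid 1" "g w2 = Mid 2" "g z1 = Leaf 1" "g z2 = Leaf 2"
    using ne ne' by (auto simp: g_def)
  have "subgraph H G"
    unfolding subgraph_def compatible_def
    using wf wf_digraph e1 e2 e3 e4 E adj_in_verts by (auto simp: H_def)
  moreover have "digraph_iso H (subdivided_in_star 2)"
    unfolding digraph_iso_def
  proof (intro exI conjI)
    show "pre_digraph.digraph_isomorphism H f"
      unfolding pre_digraph.digraph_isomorphism_def
      using wf g e1 e2 e3 e4 by (auto simp: f_def H_def inj_on_def)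
    show "subdivided_in_star 2 = app_iso f H"
      using g e1 e2 e3 e4 by (auto simp: subdivided_in_star_2 app_iso_def f_def H_def)
  qed
  ultimately show False using assms by (auto simp: digraph_free_def)
qed

text \<open>The four arcs of the star are pulled back along the isomorphism one by one. Injectivity
  on vertices then merges the separate preimages of \<open>Mid 1\<close>, \<open>Mid 2\<close> and
  \<open>Center\<close>.\<close>

lemma digraph_free_subdivided_in_starI:
  assumes "rel.subdivided_star_free"
  shows "digraph_free (subdivided_in_star 2) G"
  unfolding digraph_free_def digraph_iso_def
proof clarify
  fix H f
  assume sub: "subgraph H G" and iso: "pre_digraph.digraph_isomorphism H f"
    and eq: "subdivided_in_star 2 = app_iso f H"
  have arcs_eq: "iso_arcs f ` arcs H =
      {(Leaf 1, Mid 1), (Leaf 2, Mid 2), (Mid 1, Center), (Mid 2, Center)}"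
    and fst: "iso_tail f = fst" and snd: "iso_head f = snd"
    using eq by (simp_all add: subdivided_in_star_2 app_iso_def)
  have wfH: "wf_digraph H" using sub by (simp add: subgraph_def)
  have pull: "\<exists>u v. u \<in> verts H \<and> v \<in> verts H \<and> u \<rightarrow> v \<and> iso_verts f u = a \<and> iso_verts f v = b"
    if ab: "(a, b) \<in> iso_arcs f ` arcs H" for a b
  proof -
    obtain e where e: "e \<in> arcs H" "iso_arcs f e = (a, b)" using ab by auto
    have "iso_verts f (tail H e) = a" "iso_verts f (head H e) = b"
      using iso e fst snd unfolding pre_digraph.digraph_isomorphism_def by auto
    moreover have "tail H e \<in> verts H" "head H e \<in> verts H"
      using wfH e by (auto simp: wf_digraph_def)
    moreover have "tail H e \<rightarrow> head H e"
      using sub e by (auto simp: subgraph_def compatible_def arcs_ends_conv)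
    ultimately show ?thesis by blast
  qed
  have inj: "u = u'" if "u \<in> verts H" "u' \<in> verts H" "iso_verts f u = iso_verts f u'" for u u'
    using iso that unfolding pre_digraph.digraph_isomorphism_def by (auto dest: inj_onD)
  obtain z1 w1 where 1: "z1 \<in> verts H" "w1 \<in> verts H" "z1 \<rightarrow> w1"
      "iso_verts f z1 = Leaf 1" "iso_verts f w1 = Mid 1"
    using pull[of "Leaf 1" "Mid 1"] arcs_eq by auto
  obtain z2 w2 where 2: "z2 \<in> verts H" "w2 \<in> verts H" "z2 \<rightarrow> w2"
      "iso_verts f z2 = Leaf 2" "iso_verts f w2 = Mid 2"
    using pull[of "Leaf 2" "Mid 2"] arcs_eq by auto
  obtain w1' v where 3: "w1' \<in> verts H" "v \<in> verts H" "w1' \<rightarrow> v"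
      "iso_verts f w1' = Mid 1" "iso_verts f v = Center"
    using pull[of "Mid 1" Center] arcs_eq by auto
  obtain w2' v' where 4: "w2' \<in> verts H" "v' \<in> verts H" "w2' \<rightarrow> v'"
      "iso_verts f w2' = Mid 2" "iso_verts f v' = Center"
    using pull[of "Mid 2" Center] arcs_eq by auto
  have "w1' = w1" "w2' = w2" "v' = v" using inj 1 2 3 4 by metis+
  moreover have "w1 \<noteq> w2" "z1 \<noteq> z2" "z1 \<noteq> w2" "z2 \<noteq> w1" using 1 2 by auto
  ultimately show False
    using assms 1 2 3 4 unfolding rel.subdivided_star_free_def by blast
qed

text \<open>Without parallel arcs, an arc into \<open>y\<close> is determined by its tail.\<close>

lemma in_degree_induce_subgraph:
  assumes "y \<in> Y"
  shows "in_degree (G \<restriction> Y) y = card (rel.in_nbrs y \<inter> Y)"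
proof -
  have "rel.in_nbrs y \<inter> Y = tail G ` in_arcs (G \<restriction> Y) y"
    unfolding rel.in_nbrs_def using assms by (auto simp: arcs_ends_conv)
  moreover have "inj_on (tail G) (in_arcs (G \<restriction> Y) y)"
    by (auto simp: inj_on_def arc_to_ends_def intro: no_multi_arcs)
  ultimately show ?thesis by (simp add: in_degree_def card_image)
qed

lemma extremal_partition_iff:
  "rel.extremal_partition X Y \<longleftrightarrow> verts G = X \<union> Y \<and> X \<inter> Y = {} \<and>
     (\<forall>x\<in>X. \<forall>y\<in>Y. x \<rightarrow> y) \<and> arcs (G \<restriction> X) = {} \<and>
     (\<forall>y\<in>verts (G \<restriction> Y). in_degree (G \<restriction> Y) y = 1)"
proof -
  have "arcs_ends G \<inter> X \<times> X = {} \<longleftrightarrow> arcs (G \<restriction> X) = {}"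
    by (auto simp: arcs_ends_conv)
  moreover have "X \<times> Y \<subseteq> arcs_ends G \<longleftrightarrow> (\<forall>x\<in>X. \<forall>y\<in>Y. x \<rightarrow> y)"
    by auto
  ultimately show ?thesis
    unfolding rel.extremal_partition_def by (simp add: in_degree_induce_subgraph)
qed

lemma star_free_relation:
  assumes "digraph_free (subdivided_in_star 2) G"
  shows "star_free_relation (verts G) (arcs_ends G)"
  by unfold_locales (rule subdivided_star_freeI[OF assms])

lemma card_arcs_le:
  assumes "digraph_free (subdivided_in_star 2) G" "16 \<le> card (verts G)"
  shows "card (arcs G) \<le> (card (verts G) + 1)\<^sup>2 div 4"
  using star_free_relation.card_E_le_quarter_square(1)[OF star_free_relation] assms card_arcs_ends
  by metis

text \<open>For the converse, \<open>card Y\<close> and \<open>card X + 1\<close> have sum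
  \<open>card (verts G) + 1\<close> and differ by at most 1, so their product is the quarter
  square.\<close>

lemma extremal_iff:
  assumes n: "16 \<le> card (verts G)"
  shows "digraph_free (subdivided_in_star 2) G \<and> card (arcs G) = (card (verts G) + 1)\<^sup>2 div 4 \<longleftrightarrow>
    (\<exists>X Y. rel.extremal_partition X Y \<and>
       card X \<in> {(card (verts G) - 1) div 2, card (verts G) div 2})" (is "?L \<longleftrightarrow> ?R")
proof
  assume ?L
  then show ?R
    using star_free_relation.card_E_le_quarter_square(2)[OF star_free_relation n] card_arcs_ends
    by metis
next
  assume ?R
  then obtain X Y where XY: "rel.extremal_partition X Y"
    and X: "card X \<in> {(card (verts G) - 1) div 2, card (verts G) div 2}" by blast
  have "card (verts G) = card X + card Y"
    using XY finite_verts unfolding rel.extremal_partition_def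
    by (metis card_Un_disjoint finite_Un)
  then have sum: "card Y + (card X + 1) = card (verts G) + 1"
    and near: "card Y \<le> (card X + 1) + 1 \<and> card X + 1 \<le> card Y + 1"
    using X n by auto
  have "card Y * (card X + 1) = (card (verts G) + 1)\<^sup>2 div 4"
    using near mult_eq_quarter_square_iff[of "card Y" "card X + 1"] unfolding sum by blast
  then show ?L
    using rel.extremal_partition_sound[OF XY] digraph_free_subdivided_in_starI card_arcs_ends
    by simp
qed

end

section \<open>Attaining the bound\<close>

lemma extremal_graph_exists:
  assumes n: "16 \<le> n"
  shows "\<exists>D :: (nat, nat \<times> nat) pre_digraph. oriented_graph D \<and> card (verts D) = n \<and>
    digraph_free (subdivided_in_star 2) D \<and> card (arcs D) = (n + 1)\<^sup>2 div 4"
proof -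
  define k where "k = n div 2"
  \<comment> \<open>The cyclic predecessor on \<open>{k..<n}\<close>: \<open>Y\<close> carries a
    single directed cycle, of length at least 3, hence without loops or opposite arcs.\<close>
  define p where "p y = (if y = k then n - 1 else y - 1)" for y
  define D where "D = with_proj \<lparr> pverts = {..<n},
    parcs = {(u, y). k \<le> y \<and> y < n \<and> (u < k \<or> u = p y)} \<rparr>"
  have k: "0 < k" "k + 3 \<le> n" using n by (auto simp: k_def)
  have sub: "arcs D \<subseteq> {..<n} \<times> {..<n}"
    using k by (auto simp: D_def p_def)
  have D_simps: "verts D = {..<n}" "tail D = fst" "head D = snd" "arcs_ends D = arcs D"
    "arcs D = {(u, y). k \<le> y \<and> y < n \<and> (u < k \<or> u = p y)}"
    by (auto simp: D_def)
  interpret D: oriented_graph D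
  proof
    show "finite (arcs D)" using sub finite_subset by blast
    show "tail D e \<noteq> head D e" if "e \<in> arcs D" for e
      using that k by (auto simp: D_simps p_def split: if_splits)
    show "\<not> v \<rightarrow>\<^bsub>D\<^esub> u" if "u \<rightarrow>\<^bsub>D\<^esub> v" for u v
      using that k by (auto simp: D_simps p_def split: if_splits)
  qed (use sub in \<open>auto simp: D_simps(1-4) arc_to_ends_def\<close>)
  have "D.rel.extremal_partition {..<k} {k..<n}"
    unfolding D.rel.extremal_partition_def
  proof (intro conjI ballI)
    fix y assume y: "y \<in> {k..<n}"
    have "D.rel.in_nbrs y \<inter> {k..<n} = {p y}"
      unfolding D.rel.in_nbrs_def using y k by (auto simp: D_simps p_def)
    then show "card (D.rel.in_nbrs y \<inter> {k..<n}) = 1" by simp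
  qed (use k in \<open>auto simp: D_simps\<close>)
  then have "digraph_free (subdivided_in_star 2) D \<and> card (arcs D) = (card (verts D) + 1)\<^sup>2 div 4"
    using D.extremal_iff n k_def by (auto simp: D_simps(1))
  then show ?thesis using D.oriented_graph_axioms by (auto simp: D_simps(1))
qed

lemma ex_ori_subdivided_in_star_2:
  assumes n: "16 \<le> n"
  shows "ex_ori n (subdivided_in_star 2) = (n + 1)\<^sup>2 div 4"
proof -
  have le: "card (arcs D) \<le> (n + 1)\<^sup>2 div 4"
    if "oriented_graph D" "card (verts D) = n" "digraph_free (subdivided_in_star 2) D"
    for D :: "(nat, nat \<times> nat) pre_digraph"
    using oriented_graph.card_arcs_le[of D] that n by simp
  show ?thesis
    unfolding ex_ori_def
  proof (rule Max_eqI)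
    show "finite {card (arcs D) | D :: (nat, nat \<times> nat) pre_digraph.
        oriented_graph D \<and> card (verts D) = n \<and> digraph_free (subdivided_in_star 2) D}"
      by (rule finite_subset[of _ "{..(n + 1)\<^sup>2 div 4}"]) (use le in auto)
    show "(n + 1)\<^sup>2 div 4 \<in> {card (arcs D) | D :: (nat, nat \<times> nat) pre_digraph.
        oriented_graph D \<and> card (verts D) = n \<and> digraph_free (subdivided_in_star 2) D}"
      using extremal_graph_exists[OF n] by (metis (mono_tags, lifting) mem_Collect_eq)
  qed (use le in auto)
qed

theorem theorem1p1:
  fixes n :: nat
  assumes "n \<ge> 16"
  shows "int (ex_ori n (subdivided_in_star 2)) = \<lfloor>(real n + 1)\<^sup>2 / 4\<rfloor> \<and>
    (\<forall>D :: ('a, 'b) pre_digraph. oriented_graph D \<and> card (verts D) = n \<longrightarrow>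
      (digraph_free (subdivided_in_star 2) D \<and>
         card (arcs D) = ex_ori n (subdivided_in_star 2) \<longleftrightarrow>
       (\<exists>X Y. verts D = X \<union> Y \<and> X \<inter> Y = {} \<and>
          int (card X) \<in> {\<lfloor>(real n - 1) / 2\<rfloor>, \<lceil>(real n - 1) / 2\<rceil>} \<and>
          (\<forall>x\<in>X. \<forall>y\<in>Y. x \<rightarrow>\<^bsub>D\<^esub> y) \<and>
          arcs (D \<restriction> X) = {} \<and>
          (\<forall>y\<in>verts (D \<restriction> Y). in_degree (D \<restriction> Y) y = 1))))"
proof (intro conjI allI impI)
  have "\<lfloor>(real n + 1)\<^sup>2 / 4\<rfloor> = \<lfloor>real ((n + 1)\<^sup>2) / real 4\<rfloor>" by (simp add: add.commute)
  then show "int (ex_ori n (subdivided_in_star 2)) = \<lfloor>(real n + 1)\<^sup>2 / 4\<rfloor>"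
    unfolding floor_divide_of_nat_eq using ex_ori_subdivided_in_star_2[OF assms] by simp
next
  fix D :: "('a, 'b) pre_digraph"
  assume D: "oriented_graph D \<and> card (verts D) = n"
  then interpret oriented_graph D by simp
  have fl: "\<lfloor>(real n - 1) / 2\<rfloor> = int ((n - 1) div 2)"
    using assms floor_divide_of_nat_eq[of "n - 1" 2] by (simp add: of_nat_diff)
  \<comment> \<open>Half of \<open>n - 1\<close> rounded up is half of \<open>n\<close> rounded
    down.\<close>
  have ce: "\<lceil>(real n - 1) / 2\<rceil> = int (n div 2)"
  proof -
    have "real n = 2 * real (n div 2) + real (n mod 2)"
      by (metis of_nat_add of_nat_mult of_nat_numeral mult_div_mod_eq)
    moreover have "n mod 2 = 0 \<or> n mod 2 = 1" by auto
    ultimately show ?thesis by (auto intro!: ceiling_unique)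
  qed
  show "digraph_free (subdivided_in_star 2) D \<and>
         card (arcs D) = ex_ori n (subdivided_in_star 2) \<longleftrightarrow>
       (\<exists>X Y. verts D = X \<union> Y \<and> X \<inter> Y = {} \<and>
          int (card X) \<in> {\<lfloor>(real n - 1) / 2\<rfloor>, \<lceil>(real n - 1) / 2\<rceil>} \<and>
          (\<forall>x\<in>X. \<forall>y\<in>Y. x \<rightarrow>\<^bsub>D\<^esub> y) \<and>
          arcs (D \<restriction> X) = {} \<and>
          (\<forall>y\<in>verts (D \<restriction> Y). in_degree (D \<restriction> Y) y = 1))"
    using extremal_iff assms
    unfolding fl ce ex_ori_subdivided_in_star_2[OF assms] extremal_partition_iff conjunct2[OF D]
    by (simp only: of_nat_eq_iff insert_iff empty_iff conj_ac)
qed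

end
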